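(* There exists a universal constant $C>0$ such that the following holds. Let $\mathcal{X}$ be a (totally) ordered set, and let a conservative online learning algorithm for a class $\mathcal{F}$ of functions $\mathcal{X}\to\{1,-1\}$ make at most $k$ mistakes on any sample labeled by a function of $\mathcal{F}$. Consider the realizable case: $Y=f^*(X)$ with $f^*\in\mathcal{F}$, and $S=(X_i,Y_i)_{i=1}^n$ is an i.i.d. sample. Let $S^*$ be the set of pairs $(X_i,Y_i)$ sorted according to the order of $\mathcal{X}$, and for $x\in\mathcal{X}$ let $S^*_{\preceq x}$ be the (sorted) subset of $S^*$ of pairs $(X_i,Y_i)$ such that $X_i$ precedes $x$. Define $\hat f$ as follows: if $x=X_j$ for some $j\in\{1,\dots,n\}$, then $\hat f(x)=Y_j$; otherwise, $\hat f(x)$ is the label of $x$ given by the last classifier obtained after running the online algorithm on $S^*_{\preceq x}$. Then for every $\delta\in(0,1)$, with probability at least $1-\delta$, $$R(\hat f)\le C\,\frac{k\log(\frac1\delta)}{n}.$$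
   Context: An online learning algorithm processes labeled points one by one, maintaining a current classifier with which it predicts the label of the next point before seeing the label; a mistake is an incorrect prediction. It is conservative if it does not change its state after a correct classification of the next point. The risk is $R(f)=P(f(X)\ne Y)$. $\log(x)$ denotes the truncated logarithm $\ln(\max(x,e))$.
   Formalization: The formal theorem additionally assumes that f* is measurable and that the label f̂(x) is jointly measurable in the sample and x; without this the claim fails (e.g. on reversed ω₁ with the countable/co-countable measure). *)

theory Defs
  imports "HOL-Probability.Probability"
begin

text \<open>Labels are the integers 1 and -1. The state is kept apart from the classifier it
  induces, because conservativity speaks about the state.\<close>

record ('s, 'a) online_learner =
  initial_state :: 's
  classifier :: "'s \<Rightarrow> 'a \<Rightarrow> int"
  update_state :: "'s \<Rightarrow> 'a \<times> int \<Rightarrow> 's"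

definition binary_learner :: "('s, 'a) online_learner \<Rightarrow> bool" where
  "binary_learner A \<longleftrightarrow> (\<forall>s x. classifier A s x \<in> {1, -1})"

definition conservative :: "('s, 'a) online_learner \<Rightarrow> bool" where
  "conservative A \<longleftrightarrow>
     (\<forall>s x y. classifier A s x = y \<longrightarrow> update_state A s (x, y) = s)"

definition run :: "('s, 'a) online_learner \<Rightarrow> ('a \<times> int) list \<Rightarrow> 's" where
  "run A S = foldl (update_state A) (initial_state A) S"

definition mistakes :: "('s, 'a) online_learner \<Rightarrow> ('a \<times> int) list \<Rightarrow> nat" where
  "mistakes A S =
     card {i. i < length S \<and> classifier A (run A (take i S)) (fst (S ! i)) \<noteq> snd (S ! i)}"

definition mistake_bound ::
    "('s, 'a) online_learner \<Rightarrow> ('a \<Rightarrow> int) set \<Rightarrow> nat \<Rightarrow> bool" where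
  "mistake_bound A F k \<longleftrightarrow>
     (\<forall>f\<in>F. \<forall>xs. mistakes A (map (\<lambda>x. (x, f x)) xs) \<le> k)"

text \<open>The sorted sample is a set of pairs, hence the removal of duplicates. For a sample labeled
  by a function, distinct pairs have distinct points, so the sorted list is unique.\<close>

definition sorted_sample :: "('a::linorder \<times> int) list \<Rightarrow> ('a \<times> int) list" where
  "sorted_sample S = sort_key fst (remdups S)"

definition sorted_sample_upto ::
    "('a::linorder \<times> int) list \<Rightarrow> 'a \<Rightarrow> ('a \<times> int) list" where
  "sorted_sample_upto S x = filter (\<lambda>z. fst z \<le> x) (sorted_sample S)"

definition sorted_predictor ::
    "('s, 'a::linorder) online_learner \<Rightarrow> ('a \<times> int) list \<Rightarrow> 'a \<Rightarrow> int" where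
  "sorted_predictor A S x =
     (case map_of S x of
        Some y \<Rightarrow> y
      | None \<Rightarrow> classifier A (run A (sorted_sample_upto S x)) x)"

definition labeled_sample :: "('a \<Rightarrow> int) \<Rightarrow> nat \<Rightarrow> (nat \<Rightarrow> 'a) \<Rightarrow> ('a \<times> int) list" where
  "labeled_sample f n s = map (\<lambda>i. (s i, f (s i))) [0..<n]"

definition realizable_law :: "'a measure \<Rightarrow> ('a \<Rightarrow> int) \<Rightarrow> ('a \<times> int) measure" where
  "realizable_law D f = distr D (D \<Otimes>\<^sub>M count_space UNIV) (\<lambda>x. (x, f x))"

definition risk :: "('a \<times> int) measure \<Rightarrow> ('a \<Rightarrow> int) \<Rightarrow> real" where
  "risk P f = measure P {z \<in> space P. f (fst z) \<noteq> snd z}"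

text \<open>Measurability is implicit in the informal statement, where the risk of the predictor is a
  random variable. It cannot be dropped: if the unit interval carries the reverse of a well-order
  all of whose proper initial segments are countable (which exists under the continuum
  hypothesis), then with the constant target -1 and the learner that predicts 1 until its first
  mistake and -1 afterwards, we have k = 1, but under Lebesgue measure the predictor almost surely
  has risk 1 for every n. The condition below holds if the order is a measurable relation,
  the target is measurable and the predictions of the learner depend measurably on the
  points processed and the point to be classified.\<close>

definition measurable_predictor ::
    "('s, 'a::linorder) online_learner \<Rightarrow> 'a measure \<Rightarrow> ('a \<Rightarrow> int) \<Rightarrow> nat \<Rightarrow> bool" where
  "measurable_predictor A D f n \<longleftrightarrow>
     (\<lambda>(s, x). sorted_predictor A (labeled_sample f n s) x)
       \<in> measurable (PiM {..<n} (\<lambda>_. D) \<Otimes>\<^sub>M D) (count_space UNIV)"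

definition trunc_log :: "real \<Rightarrow> real" where
  "trunc_log x = ln (max x (exp 1))"

text \<open>A bare existential would let the constant depend on the type variables, that is, on the
  ordered set. HOL cannot quantify over types inside the existential, so the
  constant of the theorem is kept below the following number, which does not depend on types.\<close>

definition universal_cap :: real where
  "universal_cap = 100"

end

theory Submission
  imports Defs
begin

text \<open>
The sorted predictor is a stable sample compression scheme of size \<open>k\<close>. A conservative learner
ignores the points that it classifies correctly, so its whole run over the sorted sample is
determined by the at most \<open>k\<close> points on which it errs. If a sub-sample \<open>W\<close> contains all those
points, then the predictor trained on \<open>W\<close> equals the predictor trained on the full sample
(lemma \<open>predictor_stable\<close>), even at the deleted points: these were classified correctly along the
way, and memorization only repeats the prediction.

Stability turns the sample into its own test set. The indices below \<open>n\<close> are distributed over \<open>2k\<close>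
residue classes modulo \<open>2k\<close>. The mistakes occupy at most \<open>k\<close> of these classes, so some \<open>k\<close> classes,
with index set \<open>I\<close>, contain them all. The predictor trained on \<open>I\<close> is then the full predictor,
and it makes no error on the remaining indices, which number at least \<open>n/4\<close> and are independent
of \<open>I\<close>. For a fixed choice of classes, a predictor with error above \<open>\<epsilon>\<close> survives such a test
with probability at most \<open>exp (-\<epsilon> n/4)\<close> (lemma \<open>prob_consistent_but_bad\<close>). There are at most \<open>4 ^ k\<close>
choices, and a union bound with \<open>\<epsilon> = 12 k log (1/\<delta>) / n\<close> leaves failure probability at most \<open>\<delta>\<close>.
When \<open>2k > n\<close> this \<open>\<epsilon>\<close> exceeds 1 and there is nothing to show; when \<open>k = 0\<close> the predictor is the
target itself.

Testing on part of the sample needs the predictors trained on sub-samples to be measurable, while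
measurability is assumed at size \<open>n\<close> only. As the predictor depends only on the set of sample points, a
sub-sample can be padded to size \<open>n\<close> by repeating one of its points
(lemma \<open>sets_subsample_error\<close>).
\<close>

section \<open>The predictor as a function of the set of sample points\<close>

definition labeled :: "('a \<Rightarrow> int) \<Rightarrow> 'a::linorder set \<Rightarrow> ('a \<times> int) list" where
  "labeled f V = map (\<lambda>x. (x, f x)) (sorted_list_of_set V)"

lemma sorted_sample_labeled_sample:
  "sorted_sample (labeled_sample f n s) = labeled f (s ` {..<n})"
proof -
  let ?S = "labeled_sample f n s"
  let ?l = "sort_key fst (remdups ?S)"
  have graph: "z = (fst z, f (fst z))" if "z \<in> set ?l" for z
    using that by (auto simp: labeled_sample_def)
  have "inj_on fst (set ?l)"
    by (auto simp: inj_on_def labeled_sample_def)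
  then have "distinct (map fst ?l)"
    by (simp add: distinct_map)
  moreover have "sorted (map fst ?l)" by simp
  moreover have "set (map fst ?l) = s ` {..<n}"
    by (auto simp: labeled_sample_def image_image lessThan_atLeast0)
  ultimately have *: "map fst ?l = sorted_list_of_set (s ` {..<n})"
    by (metis sorted_list_of_set.idem_if_sorted_distinct)
  have "?l = map (\<lambda>x. (x, f x)) (map fst ?l)"
    unfolding map_map by (rule map_idI[symmetric]) (use graph in simp)
  then show ?thesis
    unfolding labeled_def sorted_sample_def * .
qed

lemma filter_labeled:
  assumes "finite V"
  shows "filter (\<lambda>z. P (fst z)) (labeled f V) = labeled f {x \<in> V. P x}"
proof -
  have "filter P (sorted_list_of_set V) = sorted_list_of_set {x \<in> V. P x}"
    using assms
    by (intro sorted_distinct_set_unique)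
       (auto intro: sorted_filter[of "\<lambda>x. x", simplified])
  then show ?thesis
    by (simp add: labeled_def filter_map comp_def)
qed

lemma sorted_list_of_set_prefix:
  assumes "finite V" "sorted_list_of_set V = xs @ z # ys"
  shows "xs = sorted_list_of_set {x \<in> V. x < z}"
proof -
  have s: "sorted (xs @ z # ys)" and d: "distinct (xs @ z # ys)"
    using sorted_sorted_list_of_set[of V] distinct_sorted_list_of_set[of V]
    unfolding assms(2) by simp_all
  have V: "V = set xs \<union> insert z (set ys)"
    using set_sorted_list_of_set[OF assms(1)] unfolding assms(2) by simp
  have "u < z" if "u \<in> set xs" for u
    using s d that by (auto simp: sorted_append less_le)
  moreover have "z \<le> u" if "u \<in> set ys" for u
    using s that by (simp add: sorted_append)
  ultimately have "set xs = {x \<in> V. x < z}"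
    unfolding V by force
  then show ?thesis
    using s d assms(1) by (intro sorted_distinct_set_unique) (auto simp: sorted_append)
qed

text \<open>The forecast at \<open>x\<close> uses the points strictly below \<open>x\<close>, also when \<open>x\<close> is in \<open>V\<close>. At a sample
  point it is thus the prediction that the learner makes on reaching that point in the sorted
  pass.\<close>

definition forecast :: "('s, 'a::linorder) online_learner \<Rightarrow> ('a \<Rightarrow> int) \<Rightarrow> 'a set \<Rightarrow> 'a \<Rightarrow> int" where
  "forecast A f V x = classifier A (run A (labeled f {v \<in> V. v < x})) x"

definition predictor :: "('s, 'a::linorder) online_learner \<Rightarrow> ('a \<Rightarrow> int) \<Rightarrow> 'a set \<Rightarrow> 'a \<Rightarrow> int" where
  "predictor A f V x = (if x \<in> V then f x else forecast A f V x)"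

definition mistake_set :: "('s, 'a::linorder) online_learner \<Rightarrow> ('a \<Rightarrow> int) \<Rightarrow> 'a set \<Rightarrow> 'a set" where
  "mistake_set A f V = {x \<in> V. forecast A f V x \<noteq> f x}"

lemma sorted_predictor_labeled_sample:
  "sorted_predictor A (labeled_sample f n s) x = predictor A f (s ` {..<n}) x"
proof (cases "x \<in> s ` {..<n}")
  case True
  have "map_of (labeled_sample f n s) x = Some (f x)"
  proof -
    have "labeled_sample f n s = map (\<lambda>x. (x, f x)) (map s [0..<n])"
      by (simp add: labeled_sample_def)
    moreover have "x \<in> set (map s [0..<n])" using True by auto
    ultimately show ?thesis by (simp only: map_of_map_restrict) simp
  qed
  with True show ?thesis by (simp add: sorted_predictor_def predictor_def)
next
  case False
  then have "map_of (labeled_sample f n s) x = None"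
    by (auto simp: map_of_eq_None_iff labeled_sample_def)
  moreover have "{v \<in> s ` {..<n}. v \<le> x} = {v \<in> s ` {..<n}. v < x}"
    using False by (auto simp: less_le)
  ultimately show ?thesis
    using False filter_labeled[of "s ` {..<n}" "\<lambda>v. v \<le> x" f]
    by (simp add: sorted_predictor_def predictor_def forecast_def sorted_sample_upto_def
        sorted_sample_labeled_sample)
qed

section \<open>Stability under deletion of correctly classified points\<close>

lemma run_filter:
  assumes "conservative A"
    and "\<And>xs z ys. l = xs @ z # ys \<Longrightarrow> \<not> P z \<Longrightarrow> classifier A (run A xs) (fst z) = snd z"
  shows "run A (filter P l) = run A l"
  using assms(2)
proof (induction l rule: rev_induct)
  case Nil
  then show ?case by simp
next
  case (snoc z l)
  have IH: "run A (filter P l) = run A l"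
    by (rule snoc.IH) (use snoc.prems in auto)
  show ?case
  proof (cases "P z")
    case True
    with IH show ?thesis by (simp add: run_def)
  next
    case False
    then have "classifier A (run A l) (fst z) = snd z"
      using snoc.prems by blast
    then have "update_state A (run A l) (fst z, snd z) = run A l"
      using assms(1) unfolding conservative_def by blast
    with IH False show ?thesis by (simp add: run_def)
  qed
qed

text \<open>The state on reaching any \<open>x\<close> is unchanged, because each deleted point below \<open>x\<close> was classified
  correctly in the original pass and so did not alter the state there.\<close>

lemma forecast_stable:
  assumes "conservative A" "finite V" "mistake_set A f V \<subseteq> W" "W \<subseteq> V"
  shows "forecast A f W x = forecast A f V x"
proof -
  let ?U = "{v \<in> V. v < x}"
  have "run A (filter (\<lambda>z. fst z \<in> W) (labeled f ?U)) = run A (labeled f ?U)"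
  proof (rule run_filter[OF assms(1)])
    fix xs z ys
    assume l: "labeled f ?U = xs @ z # ys" and z: "fst z \<notin> W"
    from l obtain us v vs where split: "sorted_list_of_set ?U = us @ v # vs"
      and xs: "xs = map (\<lambda>x. (x, f x)) us" and zv: "z = (v, f v)"
      unfolding labeled_def map_eq_append_conv map_eq_Cons_conv by auto
    have v: "v \<in> V" "v < x"
      using split assms(2) set_sorted_list_of_set[of ?U] by auto
    have "us = sorted_list_of_set {u \<in> ?U. u < v}"
      using sorted_list_of_set_prefix[OF _ split] assms(2) by simp
    also have "{u \<in> ?U. u < v} = {u \<in> V. u < v}"
      using v by auto
    finally have "classifier A (run A xs) (fst z) = forecast A f V v"
      by (simp add: forecast_def labeled_def xs zv)
    also have "\<dots> = f v"
      using z zv v assms(3) by (auto simp: mistake_set_def)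
    finally show "classifier A (run A xs) (fst z) = snd z"
      by (simp add: zv)
  qed
  moreover have "{v \<in> ?U. v \<in> W} = {v \<in> W. v < x}"
    using assms(4) by auto
  ultimately show ?thesis
    using filter_labeled[of ?U "\<lambda>v. v \<in> W" f] assms(2) by (simp add: forecast_def)
qed

text \<open>The only case not covered by the stability of forecasts is a point \<open>x\<close> of \<open>V\<close> outside \<open>W\<close>,
  whose label is no longer memorized; as \<open>x\<close> is not a mistake, its forecast is that label.\<close>

lemma predictor_stable:
  assumes "conservative A" "finite V" "mistake_set A f V \<subseteq> W" "W \<subseteq> V"
  shows "predictor A f W = predictor A f V"
  using forecast_stable[OF assms] assms(3,4)
  by (auto simp: predictor_def mistake_set_def fun_eq_iff)

lemma card_mistake_set:
  assumes "mistake_bound A F k" "f \<in> F" "finite V"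
  shows "card (mistake_set A f V) \<le> k"
proof -
  let ?xs = "sorted_list_of_set V"
  let ?S = "map (\<lambda>x. (x, f x)) ?xs"
  let ?N = "{i. i < length ?S \<and> classifier A (run A (take i ?S)) (fst (?S ! i)) \<noteq> snd (?S ! i)}"
  have "mistake_set A f V \<subseteq> (\<lambda>i. ?xs ! i) ` ?N"
  proof
    fix x assume x: "x \<in> mistake_set A f V"
    then have "x \<in> set ?xs" using assms(3) by (simp add: mistake_set_def)
    then obtain i where i: "i < length ?xs" "?xs ! i = x"
      by (auto simp: in_set_conv_nth)
    have "take i ?xs = sorted_list_of_set {v \<in> V. v < x}"
      using sorted_list_of_set_prefix[OF assms(3) id_take_nth_drop[OF i(1)]] i by simp
    then have "classifier A (run A (take i ?S)) x = forecast A f V x"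
      by (simp add: forecast_def labeled_def take_map)
    with x i have "i \<in> ?N" by (simp add: mistake_set_def)
    with i show "x \<in> (\<lambda>i. ?xs ! i) ` ?N" by blast
  qed
  then have "card (mistake_set A f V) \<le> card ?N"
    by (rule surj_card_le[rotated]) simp
  also have "\<dots> = mistakes A ?S"
    unfolding mistakes_def by simp
  also have "\<dots> \<le> k"
    using assms(1,2) unfolding mistake_bound_def by blast
  finally show ?thesis .
qed

text \<open>Adding the query point \<open>x\<close> to the sample creates no mistake, so by stability the predictor does
  not change; but the enlarged sample memorizes the label of \<open>x\<close>.\<close>

lemma predictor_exact_if_mistake_bound_0:
  assumes "conservative A" "mistake_bound A F 0" "f \<in> F" "finite V"
  shows "predictor A f V = f"
proof
  fix x
  have "card (mistake_set A f (insert x V)) = 0"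
    using card_mistake_set[OF assms(2,3), of "insert x V"] assms(4) by simp
  then have "mistake_set A f (insert x V) = {}"
    using assms(4) by (auto simp: mistake_set_def)
  then have "predictor A f V = predictor A f (insert x V)"
    using assms(1,4) by (intro predictor_stable) auto
  then show "predictor A f V x = f x" by (simp add: predictor_def)
qed

section \<open>Splitting the indices into residue classes\<close>

lemma residue_classes:
  fixes n k :: nat
  assumes "Q \<subseteq> {..<n}" "card Q \<le> k" "0 < k"
  obtains J where "J \<subseteq> {..<2 * k}" "card J = k" "Q \<subseteq> {i. i < n \<and> i mod (2 * k) \<in> J}"
proof -
  let ?R = "(\<lambda>i. i mod (2 * k)) ` Q"
  have "finite Q" using assms(1) finite_subset by blast
  then have "card ?R \<le> k" using card_image_le[of Q] assms(2) le_trans by blast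
  moreover have "?R \<subseteq> {..<2 * k}" using assms(3) by auto
  ultimately obtain J where "?R \<subseteq> J" "J \<subseteq> {..<2 * k}" "card J = k"
    using exists_subset_between[of ?R k "{..<2 * k}"] by auto
  with that show ?thesis using assms(1) by blast
qed

text \<open>Each of the \<open>k\<close> classes outside \<open>J\<close> has at least \<open>m = n div (2 * k)\<close> members below \<open>n\<close>. Since
  \<open>m \<ge> 1\<close>, also \<open>n < 2 * k * (m + 1) \<le> 4 * k * m\<close>.\<close>

lemma card_residue_classes:
  fixes n k :: nat
  assumes "J \<subseteq> {..<2 * k}" "card J = k" "0 < k" "2 * k \<le> n"
  shows "n \<le> 4 * card {i. i < n \<and> i mod (2 * k) \<notin> J}"
proof -
  let ?m = "n div (2 * k)"
  let ?c = "\<lambda>(j, q). j + 2 * k * q"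
  let ?P = "({..<2 * k} - J) \<times> {..<?m}"
  have "inj_on ?c ?P"
  proof (rule inj_on_inverseI)
    fix p assume "p \<in> ?P"
    then show "(\<lambda>i. (i mod (2 * k), i div (2 * k))) (?c p) = p"
      by (cases p) auto
  qed
  moreover have "?c ` ?P \<subseteq> {i. i < n \<and> i mod (2 * k) \<notin> J}"
  proof (clarsimp)
    fix j q assume jq: "j < 2 * k" "q < ?m"
    have "j + 2 * k * q < 2 * k * Suc q" using jq by simp
    also have "\<dots> \<le> 2 * k * ?m" using jq by (intro mult_le_mono2) simp
    also have "\<dots> \<le> n" by (rule times_div_less_eq_dividend)
    finally show "j + 2 * k * q < n" .
  qed
  ultimately have "card ?P \<le> card {i. i < n \<and> i mod (2 * k) \<notin> J}"
    by (intro card_inj_on_le[of ?c]) auto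
  moreover have "card ?P = k * ?m"
    using assms(1,2) by (simp add: card_cartesian_product card_Diff_subset finite_subset)
  moreover have "n \<le> 4 * (k * ?m)"
  proof -
    have "1 \<le> ?m" using assms(3,4) by (simp add: div_greater_zero_iff Suc_leI)
    then have "2 * k \<le> 2 * k * ?m" by (cases ?m) auto
    moreover have "n = 2 * k * ?m + n mod (2 * k)" by simp
    moreover have "n mod (2 * k) < 2 * k" using assms(3) by simp
    ultimately show ?thesis by linarith
  qed
  ultimately show ?thesis by linarith
qed

section \<open>Testing a classifier on independent points\<close>

text \<open>Below, \<open>B\<close> collects the pairs of a training sample and a point misclassified after training.\<close>

lemma sets_consistent_but_bad:
  assumes "prob_space D" "finite T" "B \<in> sets (PiM I (\<lambda>_. D) \<Otimes>\<^sub>M D)"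
  shows "{s \<in> space (PiM (I \<union> T) (\<lambda>_. D)).
      \<epsilon> < measure D {x \<in> space D. (restrict s I, x) \<in> B} \<and> (\<forall>i\<in>T. (restrict s I, s i) \<notin> B)}
    \<in> sets (PiM (I \<union> T) (\<lambda>_. D))"
proof -
  interpret D: prob_space D by fact
  let ?P = "PiM (I \<union> T) (\<lambda>_. D)"
  have res[measurable]: "(\<lambda>s. restrict s I) \<in> ?P \<rightarrow>\<^sub>M PiM I (\<lambda>_. D)"
    by (rule measurable_restrict_subset) simp
  have B[measurable]: "B \<in> sets (PiM I (\<lambda>_. D) \<Otimes>\<^sub>M D)" by fact
  have "(\<lambda>s. measure D (Pair (restrict s I) -` B)) \<in> borel_measurable ?P"
  proof -
    have "(\<lambda>u. emeasure D (Pair u -` B)) \<in> borel_measurable (PiM I (\<lambda>_. D))"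
      by (rule D.measurable_emeasure_Pair) fact
    then have "(\<lambda>s. emeasure D (Pair (restrict s I) -` B)) \<in> borel_measurable ?P"
      by (rule measurable_compose[OF res])
    then show ?thesis unfolding measure_def by measurable
  qed
  moreover have "{x \<in> space D. (restrict s I, x) \<in> B} = Pair (restrict s I) -` B" for s
    using sets.sets_into_space[OF B] by (auto simp: space_pair_measure)
  ultimately have m1[measurable]: "(\<lambda>s. measure D {x \<in> space D. (restrict s I, x) \<in> B}) \<in> borel_measurable ?P"
    by simp
  have "Measurable.pred ?P (\<lambda>s. (restrict s I, s i) \<in> B)" if "i \<in> T" for i
  proof -
    have [measurable]: "(\<lambda>s. s i) \<in> ?P \<rightarrow>\<^sub>M D"
      using that by (intro measurable_component_singleton) simp
    show ?thesis by measurable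
  qed
  then have [measurable]: "Measurable.pred ?P (\<lambda>s. \<forall>i\<in>T. (restrict s I, s i) \<notin> B)"
    using assms(2) by (intro pred_intros_finite(3) pred_intros_logic) auto
  show ?thesis by measurable
qed

text \<open>With the training coordinates in \<open>I\<close> fixed, either the error is at most \<open>\<epsilon>\<close>, or the coordinates in
  \<open>T\<close> must all fall into a set of probability at most \<open>1 - \<epsilon> \<le> exp (-\<epsilon>)\<close>. Fubini integrates this over the
  training coordinates.\<close>

lemma prob_consistent_but_bad:
  assumes "prob_space D" "finite I" "finite T" "I \<inter> T = {}"
    and B: "B \<in> sets (PiM I (\<lambda>_. D) \<Otimes>\<^sub>M D)"
  shows "measure (PiM (I \<union> T) (\<lambda>_. D)) {s \<in> space (PiM (I \<union> T) (\<lambda>_. D)).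
      \<epsilon> < measure D {x \<in> space D. (restrict s I, x) \<in> B} \<and> (\<forall>i\<in>T. (restrict s I, s i) \<notin> B)}
    \<le> exp (- \<epsilon> * card T)" (is "measure ?P ?E \<le> _")
proof -
  interpret D: prob_space D by fact
  interpret product_sigma_finite "\<lambda>_. D" by standard
  let ?I = "PiM I (\<lambda>_. D)" and ?T = "PiM T (\<lambda>_. D)"
  interpret PI: prob_space ?I by (intro prob_space_PiM assms)
  interpret PT: prob_space ?T by (intro prob_space_PiM assms)
  interpret P: prob_space ?P by (intro prob_space_PiM assms)
  have E: "?E \<in> sets ?P" by (rule sets_consistent_but_bad) (use assms in auto)
  have merge: "merge I T \<in> ?I \<Otimes>\<^sub>M ?T \<rightarrow>\<^sub>M ?P" by (rule measurable_merge)
  let ?E' = "merge I T -` ?E \<inter> space (?I \<Otimes>\<^sub>M ?T)"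
  have fibre: "emeasure ?T (Pair u -` ?E') \<le> ennreal (exp (- \<epsilon> * card T))"
    if u: "u \<in> space ?I" for u
  proof -
    let ?G = "{x \<in> space D. (u, x) \<in> B}" and ?H = "{x \<in> space D. (u, x) \<notin> B}"
    have rest: "restrict (merge I T (u, v)) I = u" for v
      using u by (auto simp: merge_def space_PiM PiE_def extensional_def restrict_def fun_eq_iff)
    have onT: "merge I T (u, v) i = v i" if "i \<in> T" for v i
      using that assms(4) by (auto simp: merge_def)
    have G: "?G \<in> sets D"
      using sets_Pair1[OF B, of u] sets.sets_into_space[OF B]
      by (auto simp: space_pair_measure elim!: back_subst[of "\<lambda>S. S \<in> sets D"])
    have HG: "?H = space D - ?G" by auto
    have H: "?H \<in> sets D" unfolding HG using G by auto
    show ?thesis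
    proof (cases "\<epsilon> < measure D ?G")
      case False
      then have "Pair u -` ?E' = {}" by (auto simp: rest)
      then show ?thesis by simp
    next
      case True
      have "Pair u -` ?E' \<subseteq> PiE T (\<lambda>_. ?H)"
        by (auto simp: rest onT space_pair_measure space_PiM PiE_def)
      then have "emeasure ?T (Pair u -` ?E') \<le> emeasure ?T (PiE T (\<lambda>_. ?H))"
        using H assms(3) by (intro emeasure_mono sets_PiM_I_finite) auto
      also have "\<dots> = emeasure D ?H ^ card T"
        using H assms(3) by (simp add: emeasure_PiM)
      also have "\<dots> = ennreal ((1 - measure D ?G) ^ card T)"
        unfolding HG using G
        by (simp add: D.emeasure_eq_measure D.prob_compl ennreal_power)
      also have "\<dots> \<le> ennreal (exp (- \<epsilon>) ^ card T)"
      proof (intro ennreal_leI power_mono)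
        have "1 - measure D ?G \<le> 1 + (- \<epsilon>)" using True by simp
        also have "\<dots> \<le> exp (- \<epsilon>)" by (rule exp_ge_add_one_self)
        finally show "1 - measure D ?G \<le> exp (- \<epsilon>)" .
      qed (simp)
      also have "exp (- \<epsilon>) ^ card T = exp (- \<epsilon> * card T)"
        by (simp add: exp_of_nat_mult[symmetric] mult.commute)
      finally show ?thesis .
    qed
  qed
  have "emeasure ?P ?E = emeasure (distr (?I \<Otimes>\<^sub>M ?T) ?P (merge I T)) ?E"
    using distr_merge[OF assms(4,2,3)] by simp
  also have "\<dots> = emeasure (?I \<Otimes>\<^sub>M ?T) ?E'"
    using merge E by (rule emeasure_distr)
  also have "\<dots> = (\<integral>\<^sup>+ u. emeasure ?T (Pair u -` ?E') \<partial>?I)"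
    using measurable_sets[OF merge E] by (rule PT.emeasure_pair_measure_alt)
  also have "\<dots> \<le> (\<integral>\<^sup>+ u. ennreal (exp (- \<epsilon> * card T)) \<partial>?I)"
    by (intro nn_integral_mono fibre)
  also have "\<dots> = ennreal (exp (- \<epsilon> * card T))"
    by (simp add: PI.emeasure_space_1)
  finally show ?thesis
    by (simp add: P.emeasure_eq_measure)
qed

section \<open>The risk bound for the product measure\<close>

text \<open>The map \<open>pad\<close> extends a sample indexed by \<open>I\<close> to one of size \<open>n\<close> with the same set of points, which
  reduces the claim to measurability at size \<open>n\<close>.\<close>

lemma sets_subsample_error:
  assumes mp: "measurable_predictor A D f n" and f: "f \<in> D \<rightarrow>\<^sub>M count_space UNIV"
    and I: "I \<subseteq> {..<n}" "I \<noteq> {}"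
  shows "{p \<in> space (PiM I (\<lambda>_. D) \<Otimes>\<^sub>M D). predictor A f (fst p ` I) (snd p) \<noteq> f (snd p)}
    \<in> sets (PiM I (\<lambda>_. D) \<Otimes>\<^sub>M D)"
proof -
  let ?Q = "PiM I (\<lambda>_. D) \<Otimes>\<^sub>M D"
  obtain j where j: "j \<in> I" using I by auto
  define \<pi> where "\<pi> i = (if i \<in> I then i else j)" for i
  have \<pi>: "\<pi> i \<in> I" for i using j by (simp add: \<pi>_def)
  define pad where "pad u = (\<lambda>i\<in>{..<n}. u (\<pi> i))" for u :: "nat \<Rightarrow> 'b"
  have "pad \<in> PiM I (\<lambda>_. D) \<rightarrow>\<^sub>M PiM {..<n} (\<lambda>_. D)"
    unfolding pad_def by (intro measurable_restrict measurable_component_singleton \<pi>)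
  then have "(\<lambda>p. (pad (fst p), snd p)) \<in> ?Q \<rightarrow>\<^sub>M PiM {..<n} (\<lambda>_. D) \<Otimes>\<^sub>M D"
    by measurable
  from measurable_compose[OF this mp[unfolded measurable_predictor_def]]
  have m: "(\<lambda>p. predictor A f (pad (fst p) ` {..<n}) (snd p)) \<in> ?Q \<rightarrow>\<^sub>M count_space UNIV"
    by (simp add: sorted_predictor_labeled_sample)
  have "pad u ` {..<n} = u ` I" for u
  proof -
    have "\<pi> ` {..<n} = I"
    proof
      show "I \<subseteq> \<pi> ` {..<n}"
        using I(1) by (auto simp: \<pi>_def image_iff subset_iff)
    qed (use \<pi> in auto)
    then show ?thesis
      unfolding pad_def by (metis image_image image_restrict_eq)
  qed
  with m have [measurable]:
    "(\<lambda>p. predictor A f (fst p ` I) (snd p)) \<in> ?Q \<rightarrow>\<^sub>M count_space UNIV"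
    by simp
  have [measurable]: "f \<in> D \<rightarrow>\<^sub>M count_space UNIV" by fact
  show ?thesis by measurable
qed

text \<open>The union bound over the choices \<open>J\<close> of \<open>k\<close> residue classes. The choice that contains the
  mistakes depends on the sample, so all of them have to be tested.\<close>

lemma prob_predictor_error:
  fixes A :: "('s, 'a::linorder) online_learner"
  assumes A: "conservative A" "mistake_bound A F k" and f: "f \<in> F"
    and D: "prob_space D" and fm: "f \<in> D \<rightarrow>\<^sub>M count_space UNIV"
    and mp: "measurable_predictor A D f n" and k: "0 < k" "2 * k \<le> n" and \<epsilon>: "0 \<le> \<epsilon>"
  shows "measure (PiM {..<n} (\<lambda>_. D)) {s \<in> space (PiM {..<n} (\<lambda>_. D)).
      \<epsilon> < measure D {x \<in> space D. predictor A f (s ` {..<n}) x \<noteq> f x}}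
    \<le> 4 ^ k * exp (- \<epsilon> * n / 4)" (is "measure ?P ?E \<le> _")
proof -
  interpret P: prob_space ?P by (intro prob_space_PiM D)
  define \<J> where "\<J> = {J. J \<subseteq> {..<2 * k} \<and> card J = k}"
  define I where "I J = {i. i < n \<and> i mod (2 * k) \<in> J}" for J
  define T where "T J = {i. i < n \<and> i mod (2 * k) \<notin> J}" for J
  define B where "B J = {p \<in> space (PiM (I J) (\<lambda>_. D) \<Otimes>\<^sub>M D).
      predictor A f (fst p ` I J) (snd p) \<noteq> f (snd p)}" for J
  define G where "G J = {s \<in> space ?P. \<epsilon> < measure D {x \<in> space D. (restrict s (I J), x) \<in> B J}
      \<and> (\<forall>i\<in>T J. (restrict s (I J), s i) \<notin> B J)}" for J
  have IT: "I J \<union> T J = {..<n}" "I J \<inter> T J = {}" "finite (I J)" "finite (T J)" for J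
    by (auto simp: I_def T_def)
  have fin: "finite \<J>" by (simp add: \<J>_def)
  have B: "B J \<in> sets (PiM (I J) (\<lambda>_. D) \<Otimes>\<^sub>M D)" if "J \<in> \<J>" for J
  proof -
    \<comment> \<open>A sub-sample without points cannot be padded, so \<open>I J\<close> must be non-empty.\<close>
    have "J \<noteq> {}" "J \<subseteq> {..<2 * k}" using that k(1) by (auto simp: \<J>_def)
    then obtain j where "j \<in> J" "j < 2 * k" by auto
    then have "j \<in> I J" using k by (simp add: I_def)
    then show ?thesis
      unfolding B_def using IT(1)[of J] by (intro sets_subsample_error[OF mp fm]) auto
  qed
  have GP: "G J \<in> sets ?P" if "J \<in> \<J>" for J
    using sets_consistent_but_bad[OF D IT(4)[of J] B[OF that], where \<epsilon> = \<epsilon>] unfolding G_def IT(1) .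
  have G_le: "measure ?P (G J) \<le> exp (- \<epsilon> * n / 4)" if "J \<in> \<J>" for J
  proof -
    have "n \<le> 4 * card (T J)"
      using card_residue_classes[of J k n] that k by (simp add: \<J>_def T_def)
    then have "real n / 4 \<le> card (T J)" by linarith
    from mult_left_mono[OF this \<epsilon>] have "exp (- \<epsilon> * card (T J)) \<le> exp (- \<epsilon> * n / 4)"
      by simp
    with prob_consistent_but_bad[OF D IT(3) IT(4,2)[of J] B[OF that], where \<epsilon> = \<epsilon>] show ?thesis
      unfolding G_def IT(1) by linarith
  qed
  have inB: "(restrict s (I J), x) \<in> B J \<longleftrightarrow> predictor A f (s ` I J) x \<noteq> f x"
    if "s \<in> space ?P" "x \<in> space D" for s x J
    using that IT(1)[of J]
    by (auto simp: B_def space_pair_measure space_PiM PiE_def Pi_def)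
  have "?E \<subseteq> (\<Union>J\<in>\<J>. G J)"
  proof
    fix s assume s: "s \<in> ?E"
    let ?V = "s ` {..<n}"
    let ?K = "mistake_set A f ?V"
    have "?K \<subseteq> ?V" by (auto simp: mistake_set_def)
    \<comment> \<open>A point may occur at several indices; one index for each mistake suffices.\<close>
    then obtain Q where Q: "Q \<subseteq> {..<n}" "?K = s ` Q" "inj_on s Q"
      by (meson subset_image_inj)
    have "card Q \<le> k"
      using card_mistake_set[OF A(2) f, of ?V] Q(2,3) by (simp add: card_image)
    then obtain J where "J \<subseteq> {..<2 * k}" "card J = k" "Q \<subseteq> {i. i < n \<and> i mod (2 * k) \<in> J}"
      by (rule residue_classes[OF Q(1) _ k(1)])
    then have J: "J \<in> \<J>" "Q \<subseteq> I J"
      by (simp_all add: \<J>_def I_def)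
    have same: "predictor A f (s ` I J) = predictor A f ?V"
      using Q(2) J(2) IT(1)[of J] by (intro predictor_stable[OF A(1)]) auto
    have "predictor A f (s ` I J) (s i) = f (s i)" if "i \<in> T J" for i
      unfolding same predictor_def using that by (auto simp: T_def)
    moreover have "s i \<in> space D" if "i \<in> T J" for i
      using s that by (auto simp: space_PiM T_def)
    moreover have "{x \<in> space D. (restrict s (I J), x) \<in> B J}
        = {x \<in> space D. predictor A f ?V x \<noteq> f x}"
      using s by (auto simp: inB same)
    ultimately have "s \<in> G J"
      using s by (simp add: G_def inB)
    with J(1) show "s \<in> (\<Union>J\<in>\<J>. G J)" by blast
  qed
  then have "measure ?P ?E \<le> measure ?P (\<Union>J\<in>\<J>. G J)"
    using GP fin by (intro P.finite_measure_mono) auto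
  also have "\<dots> \<le> (\<Sum>J\<in>\<J>. measure ?P (G J))"
    using GP fin by (intro P.finite_measure_subadditive_finite) auto
  also have "\<dots> \<le> card \<J> * exp (- \<epsilon> * n / 4)"
    using G_le by (intro sum_bounded_above) auto
  also have "\<dots> \<le> 4 ^ k * exp (- \<epsilon> * n / 4)"
  proof (rule mult_right_mono)
    have "card \<J> \<le> card (Pow {..<2 * k})"
      unfolding \<J>_def by (intro card_mono) auto
    also have "\<dots> = 4 ^ k" by (simp add: card_Pow power_mult)
    finally show "real (card \<J>) \<le> 4 ^ k" by (metis of_nat_le_iff of_nat_numeral of_nat_power)
  qed simp
  finally show ?thesis .
qed

lemma trunc_log_ge_1: "1 \<le> trunc_log x"
  unfolding trunc_log_def by (subst ln_ge_iff) (auto simp: less_max_iff_disj)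

text \<open>Of the exponent \<open>3 k log (1/\<delta>)\<close>, two thirds absorb the number \<open>4 ^ k \<le> exp (2 k)\<close> of tests, and
  the rest is at least \<open>ln (1/\<delta>)\<close>.\<close>

lemma failure_budget:
  assumes "1 \<le> k" "0 < n" "0 < \<delta>"
  shows "4 ^ k * exp (- (12 * (real k * trunc_log (1 / \<delta>) / real n)) * n / 4) \<le> \<delta>"
proof -
  let ?L = "trunc_log (1 / \<delta>)"
  have L: "1 \<le> ?L" "ln (1 / \<delta>) \<le> ?L"
    using assms(3) by (simp_all add: trunc_log_ge_1) (simp add: trunc_log_def ln_mono)
  have "(4::real) \<le> exp 2"
    using power_mono[of 2 "exp 1 :: real" 2] exp_ge_add_one_self[of 1]
    by (simp add: exp_of_nat_mult[symmetric])
  then have "(4::real) ^ k \<le> exp (2 * k)"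
    using power_mono[of 4 "exp 2 :: real" k] by (simp add: exp_of_nat_mult[symmetric] mult.commute)
  then have "4 ^ k * exp (- (12 * (real k * ?L / real n)) * n / 4) \<le> exp (2 * k) * exp (- (3 * (k * ?L)))"
    using assms(2) by (intro mult_mono) auto
  also have "\<dots> = exp (2 * k - 3 * (k * ?L))"
    by (simp add: exp_diff exp_minus divide_inverse)
  also have "\<dots> \<le> exp (- ?L)"
  proof -
    have "real k \<le> k * ?L" "?L \<le> k * ?L"
      using L(1) assms(1) by (auto simp: mult_le_cancel_left1 mult_le_cancel_right1)
    then show ?thesis by simp
  qed
  also have "\<dots> \<le> exp (- ln (1 / \<delta>))" using L(2) by simp
  also have "\<dots> = \<delta>" using assms(3) by (simp add: ln_div)
  finally show ?thesis .
qed

lemma risk_realizable_law: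
  assumes f: "f \<in> D \<rightarrow>\<^sub>M count_space UNIV" and g: "g \<in> D \<rightarrow>\<^sub>M count_space UNIV"
  shows "risk (realizable_law D f) g = measure D {x \<in> space D. g x \<noteq> f x}"
proof -
  let ?Q = "D \<Otimes>\<^sub>M (count_space UNIV :: int measure)"
  have [measurable]: "f \<in> D \<rightarrow>\<^sub>M count_space UNIV" "g \<in> D \<rightarrow>\<^sub>M count_space UNIV" by fact+
  let ?N = "{z \<in> space ?Q. g (fst z) \<noteq> snd z}"
  have "?N \<in> sets ?Q" by measurable
  then have "risk (realizable_law D f) g = measure D ((\<lambda>x. (x, f x)) -` ?N \<inter> space D)"
    unfolding risk_def realizable_law_def space_distr by (intro measure_distr) measurable
  also have "(\<lambda>x. (x, f x)) -` ?N \<inter> space D = {x \<in> space D. g x \<noteq> f x}"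
    by (auto simp: space_pair_measure)
  finally show ?thesis .
qed

lemma prob_predictor_error_le:
  fixes A :: "('s, 'a::linorder) online_learner"
  assumes A: "conservative A" "mistake_bound A F k" and f: "f \<in> F"
    and D: "prob_space D" and fm: "f \<in> D \<rightarrow>\<^sub>M count_space UNIV"
    and mp: "measurable_predictor A D f n" and n: "0 < n" and \<delta>: "0 < \<delta>"
  shows "measure (PiM {..<n} (\<lambda>_. D)) {s \<in> space (PiM {..<n} (\<lambda>_. D)).
      12 * (real k * trunc_log (1 / \<delta>) / real n)
        < measure D {x \<in> space D. predictor A f (s ` {..<n}) x \<noteq> f x}} \<le> \<delta>"
    (is "measure ?P {s \<in> _. ?\<epsilon> < ?err s} \<le> _")
proof -
  interpret D: prob_space D by fact
  have L: "1 \<le> trunc_log (1 / \<delta>)"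
    by (rule trunc_log_ge_1)
  consider "k = 0" | "n < 2 * k" | "0 < k" "2 * k \<le> n" by linarith
  then show ?thesis
  proof cases
    case 1
    then have "predictor A f (s ` {..<n}) = f" for s
      using predictor_exact_if_mistake_bound_0[of A F f] A f by simp
    with 1 \<delta> show ?thesis by simp
  next
    case 2
    have "real n \<le> k * trunc_log (1 / \<delta>) * 2"
      using 2 mult_left_mono[OF L, of k] by linarith
    then have "1 \<le> ?\<epsilon>" using n by (simp add: field_simps)
    then have "\<not> ?\<epsilon> < ?err s" for s
      using D.prob_le_1[of "{x \<in> space D. predictor A f (s ` {..<n}) x \<noteq> f x}"] by linarith
    with \<delta> show ?thesis by simp
  next
    case 3
    have "0 \<le> ?\<epsilon>" using L by simp
    from prob_predictor_error[OF A f D fm mp 3 this] failure_budget[of k n \<delta>] 3 n \<delta>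
    show ?thesis by linarith
  qed
qed

section \<open>The risk of the sorted predictor\<close>

theorem mainTheorem13:
  "\<exists>C::real. 0 < C \<and> C \<le> universal_cap \<and>
    (\<forall>(F :: ('a::linorder \<Rightarrow> int) set) (A :: ('s, 'a) online_learner) (k::nat) (n::nat)
       (D :: 'a measure) (fstar :: 'a \<Rightarrow> int) (M :: 'w measure) (X :: nat \<Rightarrow> 'w \<Rightarrow> 'a) (\<delta>::real).
       (\<forall>f\<in>F. range f \<subseteq> {1, -1}) \<longrightarrow>
       binary_learner A \<longrightarrow>
       conservative A \<longrightarrow>
       mistake_bound A F k \<longrightarrow>
       prob_space D \<longrightarrow>
       fstar \<in> F \<longrightarrow>
       fstar \<in> measurable D (count_space UNIV) \<longrightarrow>
       0 < n \<longrightarrow>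
       measurable_predictor A D fstar n \<longrightarrow>
       prob_space M \<longrightarrow>
       prob_space.indep_vars M (\<lambda>_. D) X {..<n} \<longrightarrow>
       (\<forall>i<n. distr M D (X i) = D) \<longrightarrow>
       0 < \<delta> \<longrightarrow> \<delta> < 1 \<longrightarrow>
       measure M {\<omega> \<in> space M.
           risk (realizable_law D fstar)
             (sorted_predictor A (labeled_sample fstar n (\<lambda>i. X i \<omega>)))
           \<le> C * (real k * trunc_log (1 / \<delta>) / real n)} \<ge> 1 - \<delta>)"
proof (intro exI[of _ 12] conjI allI impI)
  fix F :: "('a \<Rightarrow> int) set" and A :: "('s, 'a) online_learner" and k n :: nat
    and D :: "'a measure" and f :: "'a \<Rightarrow> int" and M :: "'w measure"
    and X :: "nat \<Rightarrow> 'w \<Rightarrow> 'a" and \<delta> :: real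
  assume A: "conservative A" "mistake_bound A F k" and D: "prob_space D" and f: "f \<in> F"
    and fm: "f \<in> D \<rightarrow>\<^sub>M count_space UNIV" and n: "0 < n"
    and mp: "measurable_predictor A D f n" and M: "prob_space M"
    and indep: "prob_space.indep_vars M (\<lambda>_. D) X {..<n}"
    and law: "\<forall>i<n. distr M D (X i) = D" and \<delta>: "0 < \<delta>"
  interpret D: prob_space D by fact
  interpret M: prob_space M by fact
  let ?P = "PiM {..<n} (\<lambda>_. D)"
  interpret P: prob_space ?P by (intro prob_space_PiM D)
  let ?\<epsilon> = "12 * (real k * trunc_log (1 / \<delta>) / real n)"
  define wrong where "wrong s = {x \<in> space D. predictor A f (s ` {..<n}) x \<noteq> f x}" for s
  define bad where "bad = {s \<in> space ?P. ?\<epsilon> < measure D (wrong s)}"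
  define sample where "sample \<omega> = (\<lambda>i\<in>{..<n}. X i \<omega>)" for \<omega>

  \<comment> \<open>The sample is transported to the product space, where \<open>bad\<close> is its failure event.\<close>
  have rv: "X i \<in> M \<rightarrow>\<^sub>M D" if "i < n" for i
    using indep that by (auto simp: M.indep_vars_def)
  have sample: "sample \<in> M \<rightarrow>\<^sub>M ?P"
    unfolding sample_def by (intro measurable_restrict rv) simp
  have law_sample: "distr M ?P sample = ?P"
  proof -
    have "distr M ?P sample = PiM {..<n} (\<lambda>i. distr M D (X i))"
      using M.indep_vars_iff_distr_eq_PiM'[of "{..<n}" X "\<lambda>_. D"] indep n rv
      unfolding sample_def by auto
    also have "\<dots> = ?P" using law by (intro PiM_cong) auto
    finally show ?thesis .
  qed

  have pm: "predictor A f (s ` {..<n}) \<in> D \<rightarrow>\<^sub>M count_space UNIV" if "s \<in> space ?P" for s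
    using measurable_Pair2[OF mp[unfolded measurable_predictor_def] that]
    by (simp add: sorted_predictor_labeled_sample)
  have "{p \<in> space (?P \<Otimes>\<^sub>M D). predictor A f (fst p ` {..<n}) (snd p) \<noteq> f (snd p)}
      \<in> sets (?P \<Otimes>\<^sub>M D)"
    using n by (intro sets_subsample_error[OF mp fm]) auto
  from D.measurable_emeasure_Pair[OF this]
  have "(\<lambda>s. emeasure D (wrong s)) \<in> borel_measurable ?P"
    by (rule measurable_cong[THEN iffD1, rotated])
       (auto simp: wrong_def space_pair_measure intro!: arg_cong[where f = "emeasure D"])
  then have "(\<lambda>s. measure D (wrong s)) \<in> borel_measurable ?P"
    unfolding measure_def by measurable
  then have bad: "bad \<in> sets ?P"
    unfolding bad_def by measurable

  have risk: "risk (realizable_law D f) (sorted_predictor A (labeled_sample f n (\<lambda>i. X i \<omega>)))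
      = measure D (wrong (sample \<omega>))" if "\<omega> \<in> space M" for \<omega>
  proof -
    have "sorted_predictor A (labeled_sample f n (\<lambda>i. X i \<omega>)) = predictor A f (sample \<omega> ` {..<n})"
      by (simp add: fun_eq_iff sorted_predictor_labeled_sample sample_def)
    then show ?thesis
      using risk_realizable_law[OF fm pm] measurable_space[OF sample that] by (simp add: wrong_def)
  qed
  have "{\<omega> \<in> space M. risk (realizable_law D f)
      (sorted_predictor A (labeled_sample f n (\<lambda>i. X i \<omega>))) \<le> ?\<epsilon>}
      = sample -` (space ?P - bad) \<inter> space M"
    using measurable_space[OF sample] by (auto simp: risk bad_def)
  also have "measure M \<dots> = measure (distr M ?P sample) (space ?P - bad)"
    using bad by (intro measure_distr[symmetric] sample) auto
  also have "\<dots> = 1 - measure ?P bad"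
    unfolding law_sample using bad by (rule P.prob_compl)
  also have "\<dots> \<ge> 1 - \<delta>"
    using prob_predictor_error_le[OF A f D fm mp n \<delta>] by (simp add: bad_def wrong_def)
  finally show "1 - \<delta> \<le> measure M {\<omega> \<in> space M. risk (realizable_law D f)
      (sorted_predictor A (labeled_sample f n (\<lambda>i. X i \<omega>))) \<le> ?\<epsilon>}" .
qed (simp_all add: universal_cap_def)

end
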